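(* Let $p_1$ be any mesh pattern, and let $p$ be the mesh pattern obtained from the length-1 mesh pattern $Y=(1,\{(0,0),(0,1),(1,0)\})$ by inserting $p_1$ in the (unshaded) box $(1,1)$. Then $$A_p(x)=(1-x)F(x)+xA_{p_1}(x),\qquad F_p(x,q)=(1-x)F(x)+xF_{p_1}(x,q).$$
   Context: $S_n$ is the set of permutations of $\{1,\dots,n\}$, $n\ge 0$ ($S_0$ consists of the empty permutation). A mesh pattern of length $k$ is a pair $(\tau,R)$ with $\tau\in S_k$ and $R\subseteq\{0,\dots,k\}\times\{0,\dots,k\}$ (the shaded boxes). Given $\pi=\pi_1\cdots\pi_n\in S_n$ and positions $i_1<\dots<i_k$, let $v_1<\dots<v_k$ be the values $\pi_{i_1},\dots,\pi_{i_k}$ sorted increasingly, and put $i_0=v_0=0$, $i_{k+1}=v_{k+1}=n+1$. The box $(r,s)$ contains the elements $\pi_j$ with $i_r<j<i_{r+1}$ and $v_s<\pi_j<v_{s+1}$. The subsequence $\pi_{i_1}\cdots\pi_{i_k}$ is an occurrence of $(\tau,R)$ if it is order-isomorphic to $\tau$ and every box in $R$ contains no element of $\pi$. The empty pattern ($k=0$, $R=\emptyset$) is allowed and has exactly one occurrence in every permutation. Insertion of patterns: if mesh patterns are inserted in some unshaded boxes of a base mesh pattern, an occurrence of the resulting mesh pattern in $\pi$ consists of an occurrence of the base pattern in $\pi$ together with, for each inserted pattern, an occurrence of it in the permutation order-isomorphic to the sequence of all elements of $\pi$ lying in the corresponding box (unshaded boxes in which nothing is inserted are unrestricted). For a mesh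 pattern $p$, $p(\pi)$ is the number of occurrences of $p$ in $\pi$, $F_p(x,q)=\sum_{n\ge0}x^n\sum_{\pi\in S_n}q^{p(\pi)}$, $A_p(x)=\sum_{n\ge 0}x^n\,|\{\pi\in S_n: p(\pi)=0\}|$, and $F(x)=\sum_{n\ge0}n!\,x^n$. All are formal power series. *)

theory Defs
  imports
    "HOL-Combinatorics.Multiset_Permutations"
    "HOL-Computational_Algebra.Formal_Power_Series"
    "HOL-Computational_Algebra.Polynomial"
begin

text \<open>Permutations are lists in one-line notation. Positions and values are counted from 1, so
  that the \<open>i\<close>-th entry is the list element with index \<open>i - 1\<close>.\<close>

abbreviation perms :: "nat \<Rightarrow> nat list set" where
  "perms n \<equiv> permutations_of_set {1..n}"

definition entry :: "nat list \<Rightarrow> nat \<Rightarrow> nat" where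
  "entry \<pi> i = \<pi> ! (i - 1)"

definition order_iso :: "nat list \<Rightarrow> nat list \<Rightarrow> bool" where
  "order_iso xs ys \<longleftrightarrow> length xs = length ys \<and>
     (\<forall>i<length xs. \<forall>j<length xs. xs ! i < xs ! j \<longleftrightarrow> ys ! i < ys ! j)"

text \<open>The permutation order-isomorphic to a sequence of distinct numbers: each entry is replaced
  by its rank.\<close>

definition standardize :: "nat list \<Rightarrow> nat list" where
  "standardize xs = map (\<lambda>x. card {y \<in> set xs. y \<le> x}) xs"

type_synonym mesh = "nat list \<times> (nat \<times> nat) set"

definition mesh_pattern :: "mesh \<Rightarrow> bool" where
  "mesh_pattern p \<longleftrightarrow> fst p \<in> perms (length (fst p)) \<and>
     snd p \<subseteq> {0..length (fst p)} \<times> {0..length (fst p)}"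

text \<open>The grid lines: for \<open>xs = [x\<^sub>1, \<dots>, x\<^sub>k]\<close>, the list \<open>[x\<^sub>0, x\<^sub>1, \<dots>, x\<^sub>k, x\<^sub>k\<^sub>+\<^sub>1]\<close> with
  \<open>x\<^sub>0 = 0\<close> and \<open>x\<^sub>k\<^sub>+\<^sub>1 = n + 1\<close>, indexed from 0.\<close>

definition grid :: "nat \<Rightarrow> nat list \<Rightarrow> nat list" where
  "grid n xs = 0 # xs @ [n + 1]"

text \<open>The positions of the elements of \<open>\<pi>\<close> contained in the box \<open>(r, s)\<close> that is determined by
  the increasing list \<open>is\<close> of positions.\<close>

definition box :: "nat list \<Rightarrow> nat list \<Rightarrow> nat \<times> nat \<Rightarrow> nat set" where
  "box \<pi> is = (\<lambda>(r, s).
     let n = length \<pi>; vs = sort (map (entry \<pi>) is) in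
     {j \<in> {1..n}. grid n is ! r < j \<and> j < grid n is ! (r + 1) \<and>
                  grid n vs ! s < entry \<pi> j \<and> entry \<pi> j < grid n vs ! (s + 1)})"

text \<open>An occurrence is represented by its increasing list of positions.\<close>

definition occurrences :: "mesh \<Rightarrow> nat list \<Rightarrow> nat list set" where
  "occurrences p \<pi> = {is. sorted_wrt (<) is \<and> set is \<subseteq> {1..length \<pi>} \<and>
     order_iso (map (entry \<pi>) is) (fst p) \<and> (\<forall>c\<in>snd p. box \<pi> is c = {})}"

text \<open>The permutation order-isomorphic to the sequence of the elements of \<open>\<pi>\<close> in a box.\<close>

definition box_perm :: "nat list \<Rightarrow> nat list \<Rightarrow> nat \<times> nat \<Rightarrow> nat list" where
  "box_perm \<pi> is c = standardize (map (entry \<pi>) (sorted_list_of_set (box \<pi> is c)))"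

text \<open>\<open>inserted p\<^sub>0 c p\<^sub>1 p\<close>: the mesh pattern \<open>p\<close> is obtained from the base pattern \<open>p\<^sub>0\<close> by
  inserting \<open>p\<^sub>1\<close> in its unshaded box \<open>c\<close>, i.e. in every permutation the occurrences of \<open>p\<close> are
  composed of an occurrence \<open>is\<close> of \<open>p\<^sub>0\<close> and an occurrence \<open>js\<close> of \<open>p\<^sub>1\<close> in the box. The positions
  \<open>js\<close> refer to the standardized content of the box and are translated back to positions of \<open>\<pi>\<close>.
  The decomposition of an occurrence of \<open>p\<close> is unique: if \<open>c = (a, b)\<close>, then \<open>is\<close> consists of its
  first \<open>a\<close> and its last \<open>k - a\<close> positions, where \<open>k\<close> is the length of \<open>p\<^sub>0\<close>.\<close>

definition inserted :: "mesh \<Rightarrow> nat \<times> nat \<Rightarrow> mesh \<Rightarrow> mesh \<Rightarrow> bool" where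
  "inserted p\<^sub>0 c p\<^sub>1 p \<longleftrightarrow> mesh_pattern p \<and>
     c \<in> {0..length (fst p\<^sub>0)} \<times> {0..length (fst p\<^sub>0)} - snd p\<^sub>0 \<and>
     (\<forall>n. \<forall>\<pi>\<in>perms n. occurrences p \<pi> =
        {sort (is @ map (entry (sorted_list_of_set (box \<pi> is c))) js) | is js.
           is \<in> occurrences p\<^sub>0 \<pi> \<and> js \<in> occurrences p\<^sub>1 (box_perm \<pi> is c)})"

definition Y_pattern :: mesh where
  "Y_pattern = ([1], {(0, 0), (0, 1), (1, 0)})"

definition occ_count :: "mesh \<Rightarrow> nat list \<Rightarrow> nat" where
  "occ_count p \<pi> = card (occurrences p \<pi>)"

text \<open>The coefficient of \<open>x\<^sup>n\<close> in \<open>F\<^sub>p(x, q)\<close> is a polynomial in \<open>q\<close>, so \<open>F\<^sub>p\<close> is a formal power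
  series in \<open>x\<close> over the polynomials in \<open>q\<close>. The series \<open>F\<close> is needed over two coefficient rings.\<close>

definition F_pat :: "mesh \<Rightarrow> int poly fps" where
  "F_pat p = Abs_fps (\<lambda>n. \<Sum>\<pi>\<in>perms n. monom 1 (occ_count p \<pi>))"

definition A_pat :: "mesh \<Rightarrow> int fps" where
  "A_pat p = Abs_fps (\<lambda>n. of_nat (card {\<pi> \<in> perms n. occ_count p \<pi> = 0}))"

definition F_all :: "'a::comm_ring_1 fps" where
  "F_all = Abs_fps (\<lambda>n. of_nat (fact n))"


subsection \<open>Existence of the pattern obtained by insertion in \<open>Y\<close>\<close>

lemma grid_row_exists:
  fixes a v b :: nat
  assumes "a < v" "v < b" "v \<notin> set xs"
  shows "\<exists>s\<le>length xs. (a # xs @ [b]) ! s < v \<and> v < (a # xs @ [b]) ! (s + 1)"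
  using assms
proof (induction xs arbitrary: a)
  case Nil
  then show ?case by auto
next
  case (Cons y ys)
  show ?case
  proof (cases "v < y")
    case True
    then show ?thesis using Cons.prems by (intro exI[of _ 0]) auto
  next
    case False
    then have "y < v" using Cons.prems by (auto simp: not_less_iff_gr_or_eq)
    with Cons obtain s where "s \<le> length ys" "(y # ys @ [b]) ! s < v" "v < (y # ys @ [b]) ! (s + 1)"
      by (metis list.set_intros(2))
    then show ?thesis by (intro exI[of _ "Suc s"]) auto
  qed
qed

lemma box_iff:
  "j \<in> box \<pi> is (r, s) \<longleftrightarrow> j \<in> {1..length \<pi>} \<and>
     grid (length \<pi>) is ! r < j \<and> j < grid (length \<pi>) is ! (r + 1) \<and>
     grid (length \<pi>) (sort (map (entry \<pi>) is)) ! s < entry \<pi> j \<and>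
     entry \<pi> j < grid (length \<pi>) (sort (map (entry \<pi>) is)) ! (s + 1)"
  by (auto simp: box_def Let_def)

lemma perms_length: "\<pi> \<in> perms n \<Longrightarrow> length \<pi> = n"
  using distinct_card[of \<pi>] by (auto simp: permutations_of_set_def)

lemma entry_mem: "\<pi> \<in> perms n \<Longrightarrow> j \<in> {1..n} \<Longrightarrow> entry \<pi> j \<in> {1..n}"
  using nth_mem[of "j - 1" \<pi>] perms_length[of \<pi> n]
  unfolding entry_def permutations_of_set_def by auto

lemma entry_inj: "\<pi> \<in> perms n \<Longrightarrow> i \<in> {1..n} \<Longrightarrow> j \<in> {1..n} \<Longrightarrow> entry \<pi> i = entry \<pi> j \<Longrightarrow> i = j"
  using nth_eq_iff_index_eq[of \<pi> "i - 1" "j - 1"] perms_length[of \<pi> n]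
  unfolding entry_def permutations_of_set_def by fastforce

lemma entry_surj: "\<pi> \<in> perms n \<Longrightarrow> v \<in> {1..n} \<Longrightarrow> \<exists>j\<in>{1..n}. entry \<pi> j = v"
proof -
  assume \<pi>: "\<pi> \<in> perms n" and "v \<in> {1..n}"
  then obtain t where "t < length \<pi>" "\<pi> ! t = v"
    by (metis in_set_conv_nth permutations_of_setD(1))
  then show ?thesis
    using perms_length[OF \<pi>] by (intro bexI[of _ "Suc t"]) (auto simp: entry_def)
qed

lemma shaded_start:
  assumes \<pi>: "\<pi> \<in> perms n" and s: "sorted_wrt (<) (i # is)" "set (i # is) \<subseteq> {1..n}"
    and min: "\<forall>j\<in>set is. entry \<pi> i < entry \<pi> j"
    and col: "\<forall>s\<le>Suc (length is). box \<pi> (i # is) (0, s) = {}"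
    and row: "\<forall>r\<le>Suc (length is). box \<pi> (i # is) (r, 0) = {}"
  shows "i = 1 \<and> entry \<pi> 1 = 1"
proof -
  let ?vs = "sort (map (entry \<pi>) (i # is))"
  have len: "length \<pi> = n" using \<pi> by (rule perms_length)
  have i: "i \<in> {1..n}" using s by auto
  have i1: "i = 1"
  proof (rule ccontr)
    assume "i \<noteq> 1"
    then have "1 < i" "1 \<in> {1..n}" using i by auto
    then have "1 \<notin> set (i # is)" using s by auto
    have "entry \<pi> 1 \<notin> set ?vs"
    proof
      assume "entry \<pi> 1 \<in> set ?vs"
      then obtain j where j: "j \<in> set (i # is)" "entry \<pi> 1 = entry \<pi> j"
        unfolding set_sort set_map by blast
      have "1 = j" by (rule entry_inj[OF \<pi> \<open>1 \<in> {1..n}\<close> _ j(2)]) (use s j(1) in blast)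
      with j \<open>1 \<notin> _\<close> show False by simp
    qed
    with grid_row_exists[of 0 "entry \<pi> 1" "n + 1" ?vs] entry_mem[OF \<pi> \<open>1 \<in> {1..n}\<close>]
    obtain t where "t \<le> length ?vs" "grid n ?vs ! t < entry \<pi> 1" "entry \<pi> 1 < grid n ?vs ! (t + 1)"
      by (auto simp: grid_def)
    then have "1 \<in> box \<pi> (i # is) (0, t)" "t \<le> Suc (length is)"
      using \<open>1 < i\<close> \<open>1 \<in> {1..n}\<close> by (auto simp: box_iff len grid_def)
    with col show False by blast
  qed
  have hd: "?vs = entry \<pi> i # sort (map (entry \<pi>) is)"
    using min insort_is_Cons[of "sort (map (entry \<pi>) is)" "\<lambda>x. x" "entry \<pi> i"]
    by (auto simp: less_imp_le)
  have "entry \<pi> i = 1"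
  proof (rule ccontr)
    assume ne: "entry \<pi> i \<noteq> 1"
    have "1 \<in> {1..n}" using i by auto
    with entry_surj[OF \<pi>] obtain j where j: "j \<in> {1..n}" "entry \<pi> j = 1" by blast
    have gt: "1 < entry \<pi> i" using ne entry_mem[OF \<pi> i] by auto
    have "j \<notin> set (i # is)" using min gt j by fastforce
    with grid_row_exists[of 0 j "n + 1" "i # is"] j
    obtain r where "r \<le> Suc (length is)" "grid n (i # is) ! r < j" "j < grid n (i # is) ! (r + 1)"
      by (auto simp: grid_def)
    then have "j \<in> box \<pi> (i # is) (r, 0)"
      using j gt unfolding box_iff len hd by (simp add: grid_def)
    with row \<open>r \<le> _\<close> show False by blast
  qed
  with i1 show ?thesis by simp
qed

text \<open>An explicit mesh pattern for the insertion in the box \<open>(1, 1)\<close> of \<open>Y\<close>: a new first and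
  smallest element, with the leftmost column and the lowest row of the grid shaded.\<close>

definition Y_insert :: "mesh \<Rightarrow> mesh" where
  "Y_insert p = (1 # map Suc (fst p),
     {(0, s) | s. s \<le> Suc (length (fst p))} \<union> {(r, 0) | r. r \<le> Suc (length (fst p))} \<union>
     {(Suc r, Suc s) | r s. (r, s) \<in> snd p})"

lemma Suc_perms_iff: "1 # map Suc \<sigma> \<in> perms (Suc n) \<longleftrightarrow> \<sigma> \<in> perms n"
proof -
  have "{1..Suc n} = insert 1 (Suc ` {1..n})"
    by (metis Icc_eq_insert_lb_nat One_nat_def image_Suc_atLeastAtMost le_add1 plus_1_eq_Suc)
  moreover have "1 \<notin> Suc ` set \<sigma> \<longleftrightarrow> 0 \<notin> set \<sigma>" "1 \<notin> Suc ` {1..n}" by auto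
  moreover have "insert 1 (Suc ` set \<sigma>) = insert 1 (Suc ` {1..n}) \<longleftrightarrow> set \<sigma> = {1..n}"
    if "0 \<notin> set \<sigma>"
    using that calculation(2,3) by (metis inj_Suc inj_image_eq_iff insert_ident)
  ultimately show ?thesis
    by (auto simp: permutations_of_set_def distinct_map simp del: image_Suc_atLeastAtMost)
qed

lemma starts_with_1:
  assumes "\<pi> \<in> perms n" "entry \<pi> 1 = 1" "n \<ge> 1"
  obtains \<sigma> m where "n = Suc m" "\<sigma> \<in> perms m" "\<pi> = 1 # map Suc \<sigma>"
proof -
  obtain m where m: "n = Suc m" using assms by (cases n) auto
  obtain \<rho> where \<rho>: "\<pi> = 1 # \<rho>"
    using assms perms_length[OF assms(1)] by (cases \<pi>) (auto simp: entry_def)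
  have "\<forall>x\<in>set \<rho>. x \<noteq> 0" using assms(1) \<rho> by (auto simp: permutations_of_set_def)
  then have "map (\<lambda>x. Suc (x - 1)) \<rho> = \<rho>" by (intro map_idI) auto
  then have eq: "\<pi> = 1 # map Suc (map (\<lambda>x. x - 1) \<rho>)" using \<rho> by (simp add: comp_def)
  then have "map (\<lambda>x. x - 1) \<rho> \<in> perms m"
    using assms(1) m Suc_perms_iff by metis
  with m eq that show thesis by blast
qed

lemma mesh_pattern_Y_insert:
  assumes "mesh_pattern p" shows "mesh_pattern (Y_insert p)"
  using assms Suc_perms_iff[of "fst p" "length (fst p)"]
  by (auto simp: mesh_pattern_def Y_insert_def)

lemma entry_Suc_map: "j \<in> {1..length \<sigma>} \<Longrightarrow> entry (1 # map Suc \<sigma>) (Suc j) = Suc (entry \<sigma> j)"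
  by (cases j) (auto simp: entry_def)

lemma sort_map_Suc: "sort (map Suc xs) = map Suc (sort xs)"
  by (rule properties_for_sort) (auto simp: sorted_map intro: sorted_wrt_mono_rel[OF _ sorted_sort])

lemma sort_Suc_map:
  assumes "set js \<subseteq> {1..length \<sigma>}"
  shows "sort (map (entry (1 # map Suc \<sigma>)) (1 # map Suc js)) = 1 # map Suc (sort (map (entry \<sigma>) js))"
proof -
  have "map (entry (1 # map Suc \<sigma>)) (map Suc js) = map Suc (map (entry \<sigma>) js)"
    using assms by (auto simp: entry_Suc_map[unfolded One_nat_def] subset_iff)
  moreover have "entry (1 # map Suc \<sigma>) 1 = 1" by (simp add: entry_def)
  moreover have "sort (1 # map Suc xs) = 1 # map Suc (sort xs)" for xs :: "nat list"
    unfolding sort_map_Suc[symmetric]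
    by (rule properties_for_sort) auto
  ultimately show ?thesis by (simp only: list.map)
qed

lemma grid_Suc:
  assumes "s \<le> Suc (length xs)"
  shows "grid (Suc n) (1 # map Suc xs) ! (Suc s) = Suc (grid n xs ! s)"
  using assms
  by (cases s) (auto simp: grid_def nth_append)

lemma box_Suc:
  assumes "set js \<subseteq> {1..length \<sigma>}" "r \<le> length js" "s \<le> length js"
  shows "box (1 # map Suc \<sigma>) (1 # map Suc js) (Suc r, Suc s) = Suc ` box \<sigma> js (r, s)"
proof (rule set_eqI)
  fix x
  have g: "grid (Suc (length \<sigma>)) (1 # map Suc js) ! Suc t = Suc (grid (length \<sigma>) js ! t)"
    "grid (Suc (length \<sigma>)) (1 # map Suc (sort (map (entry \<sigma>) js))) ! Suc t
       = Suc (grid (length \<sigma>) (sort (map (entry \<sigma>) js)) ! t)"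
    if "t \<le> Suc (length js)" for t
    using that by (simp_all add: grid_Suc del: One_nat_def)
  show "x \<in> box (1 # map Suc \<sigma>) (1 # map Suc js) (Suc r, Suc s) \<longleftrightarrow> x \<in> Suc ` box \<sigma> js (r, s)"
  proof (cases x)
    case 0
    then show ?thesis by (auto simp: box_iff)
  next
    case (Suc y)
    show ?thesis
    proof (cases "y \<in> {1..length \<sigma>}")
      case True
      then show ?thesis using Suc assms g[of r] g[of "Suc r"] g[of s] g[of "Suc s"]
        by (simp add: box_iff sort_Suc_map entry_Suc_map inj_image_mem_iff
            del: sort_key_simps list.map One_nat_def flip: Suc_eq_plus1)
    next
      case False
      then show ?thesis using Suc assms g[of r]
        by (auto simp: box_iff simp del: sort_key_simps list.map One_nat_def)
    qed
  qed
qed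

lemma box_Suc_0:
  assumes "\<sigma> \<in> perms n" "set js \<subseteq> {1..n}"
  shows "box (1 # map Suc \<sigma>) (1 # map Suc js) (0, s) = {}"
    "box (1 # map Suc \<sigma>) (1 # map Suc js) (r, 0) = {}"
  using assms perms_length[OF assms(1)]
  by (auto simp: box_iff sort_Suc_map grid_def simp del: sort_key_simps list.map One_nat_def)

lemma order_iso_Suc:
  assumes "set js \<subseteq> {1..length \<sigma>}" "\<forall>j\<in>set js. entry \<sigma> j \<ge> 1" "\<forall>t\<in>set \<tau>. t \<ge> 1"
  shows "order_iso (map (entry (1 # map Suc \<sigma>)) (1 # map Suc js)) (1 # map Suc \<tau>)
    \<longleftrightarrow> order_iso (map (entry \<sigma>) js) \<tau>"
proof -
  have eq: "map (entry (1 # map Suc \<sigma>)) (1 # map Suc js) = 1 # map Suc (map (entry \<sigma>) js)"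
    using assms by (auto simp: entry_Suc_map[unfolded One_nat_def] subset_iff) (simp add: entry_def)
  have "order_iso (1 # map Suc xs) (1 # map Suc \<tau>) \<longleftrightarrow> order_iso xs \<tau>"
    if "\<forall>x\<in>set xs. x \<ge> 1" for xs :: "nat list"
  proof (cases "length xs = length \<tau>")
    case True
    then have "0 < xs ! i" "0 < \<tau> ! i" if "i < length xs" for i
      using \<open>\<forall>x\<in>set xs. x \<ge> 1\<close> assms(3) that
      by (metis One_nat_def Suc_le_lessD nth_mem)+
    with True show ?thesis by (simp add: order_iso_def All_less_Suc2)
  qed (simp add: order_iso_def)
  from this[of "map (entry \<sigma>) js"] assms(2) show ?thesis unfolding eq by auto
qed

lemma occurrences_Y_insert_Suc:
  assumes p: "mesh_pattern p" and \<sigma>: "\<sigma> \<in> perms n" and js: "set js \<subseteq> {1..n}"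
  shows "1 # map Suc js \<in> occurrences (Y_insert p) (1 # map Suc \<sigma>) \<longleftrightarrow> js \<in> occurrences p \<sigma>"
proof -
  have len: "length \<sigma> = n" using \<sigma> by (rule perms_length)
  have "sorted_wrt (<) (1 # map Suc js) \<longleftrightarrow> sorted_wrt (<) js"
    using js by (auto simp: sorted_wrt_map)
  moreover have "set (1 # map Suc js) \<subseteq> {1..length (1 # map Suc \<sigma>)}" using js len by auto
  moreover have "order_iso (map (entry (1 # map Suc \<sigma>)) (1 # map Suc js)) (fst (Y_insert p))
      \<longleftrightarrow> order_iso (map (entry \<sigma>) js) (fst p)"
    unfolding Y_insert_def fst_conv
  proof (rule order_iso_Suc)
    show "\<forall>j\<in>set js. entry \<sigma> j \<ge> 1" using entry_mem[OF \<sigma>] js by fastforce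
    show "\<forall>t\<in>set (fst p). t \<ge> 1" using p by (auto simp: mesh_pattern_def permutations_of_set_def)
  qed (use js len in simp)
  moreover have "(\<forall>c\<in>snd (Y_insert p). box (1 # map Suc \<sigma>) (1 # map Suc js) c = {})
      \<longleftrightarrow> (\<forall>c\<in>snd p. box \<sigma> js c = {})" if "order_iso (map (entry \<sigma>) js) (fst p)"
  proof -
    have k: "length js = length (fst p)" using that by (simp add: order_iso_def)
    have "box (1 # map Suc \<sigma>) (1 # map Suc js) (Suc r, Suc s) = Suc ` box \<sigma> js (r, s)"
      if "(r, s) \<in> snd p" for r s
      using that p js len k by (intro box_Suc) (auto simp: mesh_pattern_def)
    then show ?thesis
      using box_Suc_0[OF \<sigma> js] by (fastforce simp: Y_insert_def)
  qed
  ultimately show ?thesis using js len unfolding occurrences_def by auto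
qed

lemma occurrences_Y_insert_start:
  assumes p: "mesh_pattern p" and \<pi>: "\<pi> \<in> perms n" and "is": "is \<in> occurrences (Y_insert p) \<pi>"
  shows "n \<ge> 1 \<and> entry \<pi> 1 = 1 \<and> (\<exists>js. set js \<subseteq> {1..n - 1} \<and> is = 1 # map Suc js)"
proof -
  have len: "length \<pi> = n" using \<pi> by (rule perms_length)
  have s: "sorted_wrt (<) is" "set is \<subseteq> {1..n}"
    and oi: "order_iso (map (entry \<pi>) is) (1 # map Suc (fst p))"
    and bx: "\<forall>c\<in>snd (Y_insert p). box \<pi> is c = {}"
    using "is" len by (auto simp: occurrences_def Y_insert_def)
  obtain i ls where l: "is = i # ls" using oi by (cases "is") (auto simp: order_iso_def)
  have k: "length ls = length (fst p)" using oi l by (auto simp: order_iso_def)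
  have st: "i = 1 \<and> entry \<pi> 1 = 1"
  proof (rule shaded_start[OF \<pi>])
    show "\<forall>j\<in>set ls. entry \<pi> i < entry \<pi> j"
    proof
      fix j assume "j \<in> set ls"
      then obtain t where t: "t < length ls" "j = ls ! t" by (auto simp: in_set_conv_nth)
      have "fst p ! t \<ge> 1" using p t k nth_mem[of t "fst p"]
        by (auto simp: mesh_pattern_def permutations_of_set_def)
      moreover have "map (entry \<pi>) is ! 0 < map (entry \<pi>) is ! Suc t \<longleftrightarrow>
          (1 # map Suc (fst p)) ! 0 < (1 # map Suc (fst p)) ! Suc t"
        using oi t(1) l k unfolding order_iso_def
        by (metis length_Cons length_map Suc_mono zero_less_Suc)
      ultimately show "entry \<pi> i < entry \<pi> j" using t l k by simp
    qed
  qed (use s l bx k in \<open>auto simp: Y_insert_def\<close>)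
  define js where "js = map (\<lambda>x. x - 1) ls"
  have gt: "1 < x \<and> x \<le> n" if "x \<in> set ls" for x using that s l st by auto
  then have "map Suc js = ls" unfolding js_def by (force intro: map_idI)
  moreover have "set js \<subseteq> {1..n - 1}" using gt unfolding js_def by fastforce
  ultimately show ?thesis using l st s by fastforce
qed

lemma occurrences_Y_start:
  assumes \<pi>: "\<pi> \<in> perms n" and "is": "is \<in> occurrences Y_pattern \<pi>"
  shows "n \<ge> 1 \<and> entry \<pi> 1 = 1 \<and> is = [1]"
proof -
  have len: "length \<pi> = n" using \<pi> by (rule perms_length)
  obtain i where l: "is = [i]" using "is"
    by (cases "is") (auto simp: occurrences_def Y_pattern_def order_iso_def)
  have bx: "box \<pi> [i] (0, 0) = {}" "box \<pi> [i] (0, 1) = {}" "box \<pi> [i] (1, 0) = {}"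
    and i: "i \<in> {1..n}"
    using "is" l len by (auto simp: occurrences_def Y_pattern_def)
  have "i = 1 \<and> entry \<pi> 1 = 1"
    by (rule shaded_start[OF \<pi>, of i "[]"]) (use bx i in \<open>auto simp: le_Suc_eq\<close>)
  with l i show ?thesis by auto
qed

lemma occurrences_Y_Suc:
  assumes "\<sigma> \<in> perms n" shows "[1] \<in> occurrences Y_pattern (1 # map Suc \<sigma>)"
  using box_Suc_0[OF assms, of "[]"]
  by (auto simp: occurrences_def Y_pattern_def order_iso_def entry_def)

lemma box_Y:
  assumes "\<sigma> \<in> perms n" shows "box (1 # map Suc \<sigma>) [1] (1, 1) = {2..<n + 2}"
proof -
  have "box \<sigma> [] (0, 0) = {1..n}"
    using entry_mem[OF assms] perms_length[OF assms] by (fastforce simp: box_iff grid_def)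
  moreover have "Suc ` {1..n} = {2..<n + 2}"
    by (simp add: image_Suc_atLeastAtMost) auto
  ultimately show ?thesis using box_Suc[of "[]" \<sigma> 0 0] by simp
qed

lemma box_perm_Y:
  assumes \<sigma>: "\<sigma> \<in> perms n" shows "box_perm (1 # map Suc \<sigma>) [1] (1, 1) = \<sigma>"
proof -
  have len: "length \<sigma> = n" using \<sigma> by (rule perms_length)
  have "map (entry (1 # map Suc \<sigma>)) [2..<n + 2] = map Suc \<sigma>"
    by (rule nth_equalityI) (auto simp: entry_def len simp del: upt_Suc)
  moreover have "standardize (map Suc \<sigma>) = \<sigma>"
    unfolding standardize_def map_map
  proof (rule map_idI)
    fix x assume x: "x \<in> set \<sigma>"
    have "{y \<in> set (map Suc \<sigma>). y \<le> Suc x} = Suc ` {1..x}"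
      using \<sigma> x by (auto simp: permutations_of_set_def)
    then show "((\<lambda>x. card {y \<in> set (map Suc \<sigma>). y \<le> x}) \<circ> Suc) x = x"
      by (simp add: card_image)
  qed
  ultimately show ?thesis
    by (simp only: box_perm_def box_Y[OF \<sigma>] sorted_list_of_set_range)
qed

lemma composed_occurrence:
  assumes "\<sigma> \<in> perms n" and "sorted_wrt (<) js" "set js \<subseteq> {1..n}"
  shows "sort ([1] @ map (entry (sorted_list_of_set (box (1 # map Suc \<sigma>) [1] (1, 1)))) js)
    = 1 # map Suc js"
proof -
  have "map (entry [2..<n + 2]) js = map Suc js"
    using assms(3) by (auto simp: entry_def subset_iff simp del: upt_Suc)
  moreover have "sorted (1 # map Suc js)"
    using assms(2) by (auto simp: sorted_map intro: sorted_wrt_mono_rel[OF _ assms(2)])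
  ultimately show ?thesis
    unfolding box_Y[OF assms(1)] by (simp only: sorted_list_of_set_range append_Cons append_Nil sort_key_id_if_sorted sorted_sort_id)
qed

theorem inserted_Y_insert:
  assumes p: "mesh_pattern p"
  shows "inserted Y_pattern (1, 1) p (Y_insert p)"
  unfolding inserted_def
proof (intro conjI allI ballI)
  show "mesh_pattern (Y_insert p)" using p by (rule mesh_pattern_Y_insert)
  show "(1, 1) \<in> {0..length (fst Y_pattern)} \<times> {0..length (fst Y_pattern)} - snd Y_pattern"
    by (simp add: Y_pattern_def)
next
  fix n \<pi> assume \<pi>: "\<pi> \<in> perms n"
  show "occurrences (Y_insert p) \<pi> =
        {sort (is @ map (entry (sorted_list_of_set (box \<pi> is (1, 1)))) js) | is js.
           is \<in> occurrences Y_pattern \<pi> \<and> js \<in> occurrences p (box_perm \<pi> is (1, 1))}" (is "_ = ?R")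
  proof (cases "n \<ge> 1 \<and> entry \<pi> 1 = 1")
    case False
    then show ?thesis
      using occurrences_Y_insert_start[OF p \<pi>] occurrences_Y_start[OF \<pi>] by blast
  next
    case True
    then obtain \<sigma> m where m: "n = Suc m" and \<sigma>: "\<sigma> \<in> perms m" and eq: "\<pi> = 1 # map Suc \<sigma>"
      using starts_with_1[OF \<pi>] by metis
    have occ: "sorted_wrt (<) js \<and> set js \<subseteq> {1..m}" if "js \<in> occurrences p \<sigma>" for js
      using that perms_length[OF \<sigma>] by (auto simp: occurrences_def)
    have "?R = {1 # map Suc js | js. js \<in> occurrences p \<sigma>}"
    proof -
      have "is \<in> occurrences Y_pattern \<pi> \<longleftrightarrow> is = [1]" for "is"
        using occurrences_Y_start[OF \<pi>] occurrences_Y_Suc[OF \<sigma>] eq by blast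
      then have "?R = {sort ([1] @ map (entry (sorted_list_of_set (box \<pi> [1] (1, 1)))) js) | js.
          js \<in> occurrences p \<sigma>}"
        using box_perm_Y[OF \<sigma>] unfolding eq by auto
      also have "\<dots> = {1 # map Suc js | js. js \<in> occurrences p \<sigma>}"
        using composed_occurrence[OF \<sigma>] occ unfolding eq by (smt (verit) Collect_cong)
      finally show ?thesis .
    qed
    also have "\<dots> = occurrences (Y_insert p) \<pi>"
      using occurrences_Y_insert_Suc[OF p \<sigma>] occurrences_Y_insert_start[OF p \<pi>] occ m eq
      by (auto, metis diff_Suc_1)
    finally show ?thesis by simp
  qed
qed

end

theory Submission
  imports Defs
begin

text \<open>Shading the three boxes \<open>(0, 0)\<close>, \<open>(0, 1)\<close>, \<open>(1, 0)\<close> of a single point forces that point to be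
  both the leftmost and the smallest element. Hence \<open>Y\<close> occurs in \<open>\<pi>\<close> exactly when \<open>\<pi>\<close> starts with 1,
  that is, \<open>\<pi> = 1 # map Suc \<sigma>\<close>; the occurrence is then unique, and its box \<open>(1, 1)\<close> contains all
  the other elements, with \<open>\<sigma>\<close> as their standardization. So an occurrence of \<open>p\<close> in \<open>\<pi>\<close> amounts to an
  occurrence of \<open>p\<^sub>1\<close> in \<open>\<sigma>\<close> (\<open>occ_count_inserted_Y\<close>), while a permutation that does not start
  with 1 has no occurrence of \<open>p\<close> at all (\<open>occ_count_inserted_Y_eq_0\<close>).

  Of the \<open>n!\<close> permutations of length \<open>n > 0\<close>, therefore, \<open>n! - (n - 1)!\<close> contribute
  \<open>q\<^sup>0 = 1\<close> each, which accounts for the term \<open>(1 - x) F(x)\<close>, and the remaining ones contribute what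
  the permutations of length \<open>n - 1\<close> contribute for \<open>p\<^sub>1\<close>, which accounts for the factor \<open>x\<close>. The
  count is made in \<open>weighted_occurrences_inserted_Y\<close> for any weight \<open>w k\<close> of a permutation with \<open>k\<close>
  occurrences such that \<open>w 0 = 1\<close>: the weight \<open>q\<^sup>k\<close> yields the identity for \<open>F\<^sub>p\<close>, and the
  indicator of \<open>k = 0\<close> yields the one for \<open>A\<^sub>p\<close>.\<close>

lemma occ_count_inserted_Y_eq_0:
  assumes "inserted Y_pattern (1, 1) p\<^sub>1 p" "\<pi> \<in> perms n" "\<not> (n \<ge> 1 \<and> entry \<pi> 1 = 1)"
  shows "occ_count p \<pi> = 0"
proof -
  have "occurrences Y_pattern \<pi> = {}"
    using occurrences_Y_start[OF assms(2)] assms(3) by blast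
  then have "occurrences p \<pi> = {}"
    using assms(1,2) unfolding inserted_def by blast
  then show ?thesis by (simp add: occ_count_def)
qed

text \<open>Prefixing 1 adds the only occurrence of \<open>Y\<close>, and every position in \<open>\<sigma>\<close> moves up by 1, so
  \<open>js \<mapsto> 1 # map Suc js\<close> is a bijection from the occurrences of \<open>p\<^sub>1\<close> onto those of \<open>p\<close>.\<close>

lemma occ_count_inserted_Y:
  assumes ins: "inserted Y_pattern (1, 1) p\<^sub>1 p" and \<sigma>: "\<sigma> \<in> perms m"
  shows "occ_count p (1 # map Suc \<sigma>) = occ_count p\<^sub>1 \<sigma>"
proof -
  let ?\<pi> = "1 # map Suc \<sigma>"
  have \<pi>: "?\<pi> \<in> perms (Suc m)" using \<sigma> Suc_perms_iff by blast
  have Y: "is \<in> occurrences Y_pattern ?\<pi> \<longleftrightarrow> is = [1]" for "is"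
    using occurrences_Y_start[OF \<pi>] occurrences_Y_Suc[OF \<sigma>] by blast
  have occ: "sort ([1] @ map (entry (sorted_list_of_set (box ?\<pi> [1] (1, 1)))) js) = 1 # map Suc js"
    if "js \<in> occurrences p\<^sub>1 \<sigma>" for js
    using that perms_length[OF \<sigma>] by (intro composed_occurrence[OF \<sigma>]) (auto simp: occurrences_def)
  have "occurrences p ?\<pi> = {sort (is @ map (entry (sorted_list_of_set (box ?\<pi> is (1, 1)))) js) | is js.
      is \<in> occurrences Y_pattern ?\<pi> \<and> js \<in> occurrences p\<^sub>1 (box_perm ?\<pi> is (1, 1))}"
    using ins \<pi> unfolding inserted_def by blast
  also have "\<dots> = (\<lambda>js. sort ([1] @ map (entry (sorted_list_of_set (box ?\<pi> [1] (1, 1)))) js)) `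
      occurrences p\<^sub>1 (box_perm ?\<pi> [1] (1, 1))"
    unfolding Y by blast
  also have "\<dots> = (\<lambda>js. 1 # map Suc js) ` occurrences p\<^sub>1 \<sigma>"
    unfolding box_perm_Y[OF \<sigma>] using occ by (rule image_cong[OF refl])
  finally have "occurrences p ?\<pi> = (\<lambda>js. 1 # map Suc js) ` occurrences p\<^sub>1 \<sigma>" .
  moreover have "inj_on (\<lambda>js. 1 # map Suc js) (occurrences p\<^sub>1 \<sigma>)"
    by (auto intro: inj_onI)
  ultimately show ?thesis by (simp add: occ_count_def card_image)
qed

lemma perms_starting_with_1:
  "{\<pi> \<in> perms (Suc m). entry \<pi> 1 = 1} = (\<lambda>\<sigma>. 1 # map Suc \<sigma>) ` perms m"
proof (intro equalityI subsetI)
  fix \<pi> assume "\<pi> \<in> {\<pi> \<in> perms (Suc m). entry \<pi> 1 = 1}"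
  then have "\<pi> \<in> perms (Suc m)" "entry \<pi> 1 = 1" by blast+
  then obtain \<sigma> k where "Suc m = Suc k" "\<sigma> \<in> perms k" "\<pi> = 1 # map Suc \<sigma>"
    by (rule starts_with_1) simp
  then show "\<pi> \<in> (\<lambda>\<sigma>. 1 # map Suc \<sigma>) ` perms m" by blast
next
  fix \<pi> assume "\<pi> \<in> (\<lambda>\<sigma>. 1 # map Suc \<sigma>) ` perms m"
  then obtain \<sigma> where "\<sigma> \<in> perms m" and \<pi>: "\<pi> = 1 # map Suc \<sigma>" by blast
  then have "\<pi> \<in> perms (Suc m)" using Suc_perms_iff by blast
  with \<pi> show "\<pi> \<in> {\<pi> \<in> perms (Suc m). entry \<pi> 1 = 1}" by (simp add: entry_def)
qed

lemma weighted_occurrences_inserted_Y: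
  fixes w :: "nat \<Rightarrow> 'a::comm_ring_1"
  assumes ins: "inserted Y_pattern (1, 1) p\<^sub>1 p" and w0: "w 0 = 1"
  shows "Abs_fps (\<lambda>n. \<Sum>\<pi>\<in>perms n. w (occ_count p \<pi>)) =
    (1 - fps_X) * F_all + fps_X * Abs_fps (\<lambda>n. \<Sum>\<pi>\<in>perms n. w (occ_count p\<^sub>1 \<pi>))"
proof (rule fps_ext)
  fix n
  show "fps_nth (Abs_fps (\<lambda>n. \<Sum>\<pi>\<in>perms n. w (occ_count p \<pi>))) n = fps_nth
    ((1 - fps_X) * F_all + fps_X * Abs_fps (\<lambda>n. \<Sum>\<pi>\<in>perms n. w (occ_count p\<^sub>1 \<pi>))) n"
  proof (cases n)
    case 0
    have "occ_count p [] = 0"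
      by (rule occ_count_inserted_Y_eq_0[OF ins, of _ 0]) auto
    then show ?thesis using 0 by (simp add: w0 F_all_def left_diff_distrib)
  next
    case (Suc m)
    let ?one = "{\<pi> \<in> perms (Suc m). entry \<pi> 1 = 1}"
    have inj: "inj_on (\<lambda>\<sigma>. 1 # map Suc \<sigma>) (perms m)"
      by (auto intro: inj_onI)
    have "card ?one = fact m"
      unfolding perms_starting_with_1 card_image[OF inj] by simp
    then have card_rest: "card (perms (Suc m) - ?one) = fact (Suc m) - fact m"
      by (subst card_Diff_subset) (auto intro: finite_subset[of _ "perms (Suc m)"])
    have "(\<Sum>\<pi>\<in>perms (Suc m) - ?one. w (occ_count p \<pi>)) = (\<Sum>\<pi>\<in>perms (Suc m) - ?one. 1)"
      using occ_count_inserted_Y_eq_0[OF ins, of _ "Suc m"] by (intro sum.cong) (auto simp: w0)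
    also have "\<dots> = of_nat (fact (Suc m)) - of_nat (fact m)"
      unfolding sum_constant card_rest
      by (simp add: of_nat_diff[OF fact_mono_nat] del: fact_Suc of_nat_fact)
    finally have rest: "(\<Sum>\<pi>\<in>perms (Suc m) - ?one. w (occ_count p \<pi>)) =
      of_nat (fact (Suc m)) - of_nat (fact m)" .
    have one: "(\<Sum>\<pi>\<in>?one. w (occ_count p \<pi>)) = (\<Sum>\<sigma>\<in>perms m. w (occ_count p\<^sub>1 \<sigma>))"
      unfolding perms_starting_with_1 sum.reindex[OF inj]
      using occ_count_inserted_Y[OF ins] by (intro sum.cong) auto
    have "(\<Sum>\<pi>\<in>perms (Suc m). w (occ_count p \<pi>)) =
      of_nat (fact (Suc m)) - of_nat (fact m) + (\<Sum>\<sigma>\<in>perms m. w (occ_count p\<^sub>1 \<sigma>))"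
      using sum.subset_diff[of ?one "perms (Suc m)" "\<lambda>\<pi>. w (occ_count p \<pi>)"]
      unfolding rest one by auto
    then show ?thesis
      using Suc by (simp add: F_all_def left_diff_distrib del: fact_Suc of_nat_fact)
  qed
qed

lemma A_pat_eq_weighted_sum:
  "A_pat p = Abs_fps (\<lambda>n. \<Sum>\<pi>\<in>perms n. if occ_count p \<pi> = 0 then 1 else 0)"
  unfolding A_pat_def by (simp flip: sum.inter_filter)

theorem theorem2p1:
  fixes p\<^sub>1 p :: mesh
  assumes "mesh_pattern p\<^sub>1"
    and "inserted Y_pattern (1, 1) p\<^sub>1 p"
  shows "A_pat p = (1 - fps_X) * F_all + fps_X * A_pat p\<^sub>1 \<and>
         F_pat p = (1 - fps_X) * F_all + fps_X * F_pat p\<^sub>1"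
proof
  show "A_pat p = (1 - fps_X) * F_all + fps_X * A_pat p\<^sub>1"
    unfolding A_pat_eq_weighted_sum
    using weighted_occurrences_inserted_Y[OF assms(2), of "\<lambda>k. if k = 0 then 1 else 0"] by simp
  show "F_pat p = (1 - fps_X) * F_all + fps_X * F_pat p\<^sub>1"
    unfolding F_pat_def
    using weighted_occurrences_inserted_Y[OF assms(2), of "monom 1"] by simp
qed

end
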